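(* Let $a,b$ be constants. Then in a neighborhood of $x=0$, $$\sum_{n=0}^\infty\binom{2n}{n}(an+b)\frac{x^n}{(1-4x)^n}\sum_{k=0}^n\binom nk^2\binom{n+k}kx^k=\sum_{n=0}^\infty\binom{3n}n\binom{2n}n^2(An+B)\frac{x^{2n}}{(1-4x)^{3n}},$$ where $$A=\frac{4a(1+2x)(1-x)}{3(1-4x+8x^2)\sqrt{1-4x}},\qquad B=\frac{1}{\sqrt{1-4x}}\Bigl(\frac{2ax(1-2x)}{1-4x+8x^2}+b\Bigr).$$
   Context: $\sqrt{1-4x}$ is the principal branch (equal to $1$ at $x=0$). *)

theory Defs
  imports "HOL-Analysis.Analysis"
begin

end

theory Submission
  imports Defs "HOL-Complex_Analysis.Complex_Analysis" "HOL-Real_Asymp.Real_Asymp"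
begin

text \<open>
  Put \<open>z = 1 - 4x\<close> and \<open>c(n,k) = C(2n,n) C(n,k)\<^sup>2 C(n+k,k)\<close>, and consider the moments
  \<open>M(i,j) = \<Sum>\<^sub>n \<Sum>\<^sub>k c(n,k) n\<^sup>i k\<^sup>j x\<^sup>k (x/z)\<^sup>n\<close> of the left-hand side.
  The operator \<open>\<theta> = z x d/dx\<close> sends \<open>M(i,j)\<close> to \<open>z M(i,j+1) + M(i+1,j)\<close>, and the
  first-order recurrences of \<open>c(n,k)\<close> in \<open>k\<close> and in \<open>n\<close> give linear relations between the
  moments. By these relations \<open>E = (1 - 6x) M(1,0) - 2(1 - x) M(0,1) - 2x M(0,0)\<close> satisfies a
  third-order linear equation in \<open>\<theta>\<close> with indicial roots 0, 0 and 1; since \<open>E = O(x\<^sup>2)\<close>,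
  it vanishes. Modulo \<open>E = \<theta>E = \<theta>\<theta>E = 0\<close>, the function \<open>M(0,0)\<close> satisfies the
  third-order equation of \<open>G = 1/\<surd>z \<Sum>\<^sub>n C(3n,n) C(2n,n)\<^sup>2 (x\<^sup>2/z\<^sup>3)\<^sup>n\<close>, which has
  the triple indicial root 0, so \<open>M(0,0) = G\<close>; this is the case \<open>a = 0\<close>. Applying \<open>\<theta>\<close>
  to \<open>M(0,0) = G\<close> and eliminating \<open>M(0,1)\<close> with \<open>E = 0\<close> yields \<open>M(1,0)\<close>.
\<close>

section \<open>The moments as holomorphic functions\<close>

text \<open>The common majorant of all moment series: geometric decay absorbs the polynomial factors
  \<open>n ^ i * k ^ j\<close>, with \<open>3 / 4\<close> as an intermediate ratio.\<close>

lemma summable_Suc_power_half_power: "summable (\<lambda>n. real (Suc n) ^ m * (1 / 2) ^ n)"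
proof (rule summable_comparison_test_bigo)
  show "summable (\<lambda>n. norm ((3 / 4 :: real) ^ n))"
    by (simp add: summable_geometric)
  show "(\<lambda>n. real (Suc n) ^ m * (1 / 2) ^ n) \<in> O(\<lambda>n. (3 / 4) ^ n)"
    by real_asymp
qed

text \<open>Domination by one summable sequence on all of \<open>S\<close> makes the convergence
  uniform, which allows termwise differentiation. Stated for general terms so that it serves both
  sides of the identity.\<close>

lemma holomorphic_series_deriv:
  fixes T :: "nat \<Rightarrow> complex \<Rightarrow> complex"
  assumes S: "open S" and hol: "\<And>n. T n holomorphic_on S" and h: "summable h"
    and bound: "\<And>n x. x \<in> S \<Longrightarrow> norm (T n x) \<le> h n"
  shows "(\<lambda>x. \<Sum>n. T n x) holomorphic_on S"
    and "x \<in> S \<Longrightarrow> (\<lambda>n. T n x) sums (\<Sum>n. T n x)"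
    and "x \<in> S \<Longrightarrow> (\<lambda>n. deriv (T n) x) sums deriv (\<lambda>x. \<Sum>n. T n x) x"
proof -
  obtain g g' where g: "\<forall>x\<in>S. (\<lambda>n. T n x) sums g x \<and> (\<lambda>n. deriv (T n) x)
      sums g' x \<and>
      (g has_field_derivative g' x) (at x)"
  proof (rule series_and_derivative_comparison[OF S h, of T "\<lambda>n. deriv (T n)"])
    show "(T n has_field_derivative deriv (T n) x) (at x)" if "x \<in> S" for n x
      using hol S that by (rule holomorphic_derivI)
  qed (use bound in auto)
  have eq: "g x = (\<Sum>n. T n x)" if "x \<in> S" for x
    using g that sums_unique by blast
  have der: "((\<lambda>x. \<Sum>n. T n x) has_field_derivative g' x) (at x)" if "x \<in> S" for x
  proof (rule has_field_derivative_transform_within_open[OF _ S that eq])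
    show "(g has_field_derivative g' x) (at x)" using g that by blast
  qed
  show "(\<lambda>x. \<Sum>n. T n x) holomorphic_on S"
    using der S holomorphic_on_open by blast
  show "(\<lambda>n. T n x) sums (\<Sum>n. T n x)" if "x \<in> S"
    using g that eq by metis
  show "(\<lambda>n. deriv (T n) x) sums deriv (\<lambda>x. \<Sum>n. T n x) x" if "x \<in> S"
    using g that DERIV_imp_deriv[OF der[OF that]] by simp
qed

definition coef :: "nat \<Rightarrow> nat \<Rightarrow> nat" where
  "coef n k = (2 * n choose n) * (n choose k)\<^sup>2 * (n + k choose k)"

definition dterm :: "nat \<Rightarrow> nat \<Rightarrow> nat \<Rightarrow> complex \<Rightarrow> complex" where
  "dterm i j n x = (\<Sum>k\<le>n. of_nat (coef n k) * (of_nat n ^ i * of_nat k ^ j) *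
     (x ^ k * (x / (1 - 4 * x)) ^ n))"

definition dmom :: "nat \<Rightarrow> nat \<Rightarrow> complex \<Rightarrow> complex" where
  "dmom i j x = (\<Sum>n. dterm i j n x)"

definition scoef :: "nat \<Rightarrow> nat" where
  "scoef n = (3 * n choose n) * (2 * n choose n)\<^sup>2"

definition sterm :: "nat \<Rightarrow> nat \<Rightarrow> complex \<Rightarrow> complex" where
  "sterm i n x = of_nat (scoef n) * of_nat n ^ i * (x\<^sup>2 / (1 - 4 * x) ^ 3) ^ n"

definition smom :: "nat \<Rightarrow> complex \<Rightarrow> complex" where
  "smom i x = (\<Sum>n. sterm i n x)"

text \<open>The radius is small enough for crude estimates: on this disc the geometric ratios are at
  most \<open>1 / 128\<close> and \<open>1 / 256\<close>, against coefficient bounds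
  \<open>64 ^ n\<close> and \<open>128 ^ n\<close>, so a ratio of \<open>1 / 2\<close> remains in
  both series.\<close>

definition disc :: "complex set" where
  "disc = ball 0 (1 / 200)"

lemma coef_le: "k \<le> n \<Longrightarrow> coef n k \<le> 64 ^ n"
proof -
  assume "k \<le> n"
  have "n + k choose k \<le> 2 ^ (n + k)" by (rule binomial_le_pow2)
  also have "\<dots> \<le> 2 ^ (2 * n)" using \<open>k \<le> n\<close> by (intro power_increasing) auto
  finally have 1: "n + k choose k \<le> 2 ^ (2 * n)" .
  have "coef n k \<le> 2 ^ (2 * n) * (2 ^ n)\<^sup>2 * 2 ^ (2 * n)"
    unfolding coef_def by (intro mult_mono power_mono 1 binomial_le_pow2) auto
  also have "\<dots> = 64 ^ n"
    by (simp add: power_mult power_mult_distrib[symmetric] power2_eq_square)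
  finally show ?thesis .
qed

lemma scoef_le: "scoef n \<le> 128 ^ n"
proof -
  have "scoef n \<le> 2 ^ (3 * n) * (2 ^ (2 * n))\<^sup>2"
    unfolding scoef_def by (intro mult_mono power_mono binomial_le_pow2) auto
  also have "\<dots> = 128 ^ n"
    by (simp add: power_mult power_mult_distrib[symmetric] power2_eq_square)
  finally show ?thesis .
qed

lemma disc_bounds:
  assumes "x \<in> disc"
  shows "norm x \<le> 1 / 200" "norm (1 - 4 * x) \<ge> 49 / 50" "1 - 4 * x \<noteq> 0"
proof -
  show 1: "norm x \<le> 1 / 200" using assms by (simp add: disc_def)
  have "norm (1::complex) - norm (4 * x) \<le> norm (1 - 4 * x)" by (rule norm_triangle_ineq2)
  then show 2: "norm (1 - 4 * x) \<ge> 49 / 50" using 1 by (simp add: norm_mult)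
  then show "1 - 4 * x \<noteq> 0" by (metis norm_zero not_le zero_less_divide_iff zero_less_numeral)
qed

text \<open>The extra \<open>+ 1\<close> in the exponent counts the \<open>n + 1\<close> summands of
  the inner sum.\<close>

lemma norm_dterm_le:
  assumes x: "x \<in> disc"
  shows "norm (dterm i j n x) \<le> real (Suc n) ^ (i + j + 1) * (1 / 2) ^ n"
proof -
  have y: "norm (x / (1 - 4 * x)) \<le> 1 / 128"
  proof -
    have "norm (x / (1 - 4 * x)) \<le> (1 / 200) / (49 / 50)"
      unfolding norm_divide using disc_bounds[OF x] by (intro frac_le) auto
    then show ?thesis by simp
  qed
  have "norm (dterm i j n x) \<le> (\<Sum>k\<le>n. 64 ^ n * (real (Suc n) ^ i * real (Suc n) ^ j) *
      (1 * (1 / 128) ^ n))"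
    unfolding dterm_def
  proof (rule sum_norm_le)
    fix k assume "k \<in> {..n}"
    then have k: "k \<le> n" by simp
    have "real (coef n k) \<le> 64 ^ n"
      using coef_le[OF k] of_nat_mono by fastforce
    then show "norm (of_nat (coef n k) * (of_nat n ^ i * of_nat k ^ j) * (x ^ k * (x / (1 - 4 * x)) ^ n))
        \<le> 64 ^ n * (real (Suc n) ^ i * real (Suc n) ^ j) * (1 * (1 / 128) ^ n)"
      unfolding norm_mult norm_power norm_of_nat using k y disc_bounds[OF x]
      by (intro mult_mono power_mono power_le_one) auto
  qed
  also have "\<dots> = real (Suc n) ^ (i + j + 1) * (64 ^ n * (1 / 128) ^ n)"
    by (simp add: power_add)
  also have "\<dots> = real (Suc n) ^ (i + j + 1) * (1 / 2) ^ n"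
    by (simp add: power_mult_distrib[symmetric])
  finally show ?thesis .
qed

lemma norm_sterm_le:
  assumes x: "x \<in> disc"
  shows "norm (sterm i n x) \<le> real (Suc n) ^ i * (1 / 2) ^ n"
proof -
  have y: "norm (x\<^sup>2 / (1 - 4 * x) ^ 3) \<le> 1 / 256"
  proof -
    have "norm (x\<^sup>2 / (1 - 4 * x) ^ 3) \<le> (1 / 200)\<^sup>2 / (49 / 50) ^ 3"
      unfolding norm_divide norm_power using disc_bounds[OF x] by (intro frac_le power_mono) auto
    then show ?thesis by (simp add: power2_eq_square power3_eq_cube)
  qed
  have "real (scoef n) \<le> 128 ^ n"
    using scoef_le of_nat_mono by fastforce
  then have "norm (sterm i n x) \<le> 128 ^ n * real (Suc n) ^ i * (1 / 256) ^ n"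
    unfolding sterm_def norm_mult norm_power norm_of_nat using y
    by (intro mult_mono power_mono) auto
  also have "\<dots> = real (Suc n) ^ i * (128 ^ n * (1 / 256) ^ n)"
    by simp
  also have "\<dots> = real (Suc n) ^ i * (1 / 2) ^ n"
    by (simp add: power_mult_distrib[symmetric])
  finally show ?thesis .
qed

lemma dterm_holomorphic: "dterm i j n holomorphic_on disc"
  unfolding dterm_def[abs_def] using disc_bounds by (intro holomorphic_intros) auto

lemma sterm_holomorphic: "sterm i n holomorphic_on disc"
  unfolding sterm_def[abs_def] using disc_bounds by (intro holomorphic_intros) auto

lemma open_disc [simp]: "open disc" and zero_in_disc [simp]: "0 \<in> disc"
  by (simp_all add: disc_def)

lemma dmom_eq_suminf: "dmom i j = (\<lambda>x. \<Sum>n. dterm i j n x)"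
  by (simp add: fun_eq_iff dmom_def)

lemma dmom_holomorphic: "dmom i j holomorphic_on disc"
  and dterm_sums: "x \<in> disc \<Longrightarrow> (\<lambda>n. dterm i j n x) sums dmom i j x"
  and deriv_dterm_sums: "x \<in> disc \<Longrightarrow> (\<lambda>n. deriv (dterm i j n) x) sums deriv (dmom
      i j) x"
  unfolding dmom_eq_suminf
  by (rule holomorphic_series_deriv[OF open_disc dterm_holomorphic
        summable_Suc_power_half_power norm_dterm_le]; assumption)+

lemma smom_eq_suminf: "smom i = (\<lambda>x. \<Sum>n. sterm i n x)"
  by (simp add: fun_eq_iff smom_def)

lemma smom_holomorphic: "smom i holomorphic_on disc"
  and sterm_sums: "x \<in> disc \<Longrightarrow> (\<lambda>n. sterm i n x) sums smom i x"
  and deriv_sterm_sums: "x \<in> disc \<Longrightarrow> (\<lambda>n. deriv (sterm i n) x) sums deriv (smom i) x"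
  unfolding smom_eq_suminf
  by (rule holomorphic_series_deriv[OF open_disc sterm_holomorphic
        summable_Suc_power_half_power norm_sterm_le]; assumption)+

text \<open>Covers \<open>n = 0\<close> as well, where the truncated exponent is harmless because of
  the factor \<open>of_nat n\<close>. This avoids dividing by \<open>x\<close>, which may be
  0.\<close>

lemma power_minus_one_mult: "of_nat n * (x::'a::comm_semiring_1) ^ (n - Suc 0) * x = of_nat n * x ^ n"
  by (cases n) (simp_all add: mult_ac)

text \<open>With \<open>z = 1 - 4 * x\<close>, the logarithmic derivative of \<open>x / z\<close> is
  \<open>1 / x + 4 / z\<close>, and \<open>z * x\<close> times it equals
  \<open>z + 4 * x = 1\<close>. Hence the operator brings down exactly \<open>n\<close> from
  \<open>(x / z) ^ n\<close>, and \<open>z * k\<close> from \<open>x ^ k\<close>.\<close>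

lemma deriv_dterm:
  assumes x: "x \<in> disc"
  shows "(1 - 4 * x) * x * deriv (dterm i j n) x = (1 - 4 * x) * dterm i (Suc j) n x + dterm (Suc i) j n x"
proof -
  define z y where "z = 1 - 4 * x" and "y = x / z"
  have z: "z \<noteq> 0" using disc_bounds[OF x] by (simp add: z_def)
  have 1: "((\<lambda>x. x / (1 - 4 * x)) has_field_derivative (1 / z\<^sup>2)) (at x)"
    using z unfolding z_def by (auto intro!: derivative_eq_intros simp: power2_eq_square)
  have 2: "((\<lambda>x. C * (x ^ k * Y x ^ n)) has_field_derivative
      C * (of_nat k * x ^ (k - Suc 0) * Y x ^ n + of_nat n * Y x ^ (n - Suc 0) * Y' * x ^ k)) (at x)"
    if "(Y has_field_derivative Y') (at x)" for C Y' :: complex and Y k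
    using that by (auto intro!: derivative_eq_intros)
  have "(dterm i j n has_field_derivative
     (\<Sum>k\<le>n. of_nat (coef n k) * (of_nat n ^ i * of_nat k ^ j) *
       (of_nat k * x ^ (k - Suc 0) * y ^ n + of_nat n * y ^ (n - Suc 0) * (1 / z\<^sup>2) * x ^ k))) (at x)"
    unfolding dterm_def[abs_def] y_def z_def by (intro DERIV_sum 2[OF 1[unfolded z_def]])
  then have "z * x * deriv (dterm i j n) x =
    (\<Sum>k\<le>n. of_nat (coef n k) * (of_nat n ^ i * of_nat k ^ j) *
       (z * (of_nat k * x ^ (k - Suc 0) * x) * y ^ n + (of_nat n * y ^ (n - Suc 0)
           * (x * z / z\<^sup>2)) * x ^ k))"
    by (simp add: DERIV_imp_deriv sum_distrib_left algebra_simps)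
  also have "x * z / z\<^sup>2 = y"
    using z by (simp add: y_def power2_eq_square)
  also have "(\<Sum>k\<le>n. of_nat (coef n k) * (of_nat n ^ i * of_nat k ^ j) *
       (z * (of_nat k * x ^ (k - Suc 0) * x) * y ^ n + (of_nat n * y ^ (n - Suc 0) * y) * x ^ k))
    = z * dterm i (Suc j) n x + dterm (Suc i) j n x"
    unfolding power_minus_one_mult dterm_def sum_distrib_left sum.distrib[symmetric] z_def[symmetric]
        y_def[symmetric]
    by (intro sum.cong) (auto simp: algebra_simps)
  finally show ?thesis by (simp add: z_def)
qed

text \<open>The logarithmic derivative of \<open>x\<^sup>2 / z ^ 3\<close> is
  \<open>2 / x + 12 / z\<close>; times \<open>z * x\<close> this is
  \<open>2 * z + 12 * x = 2 + 4 * x\<close>.\<close>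

lemma deriv_sterm:
  assumes x: "x \<in> disc"
  shows "(1 - 4 * x) * x * deriv (sterm i n) x = (2 + 4 * x) * sterm (Suc i) n x"
proof -
  define z t where "z = 1 - 4 * x" and "t = x\<^sup>2 / z ^ 3"
  have z: "z \<noteq> 0" using disc_bounds[OF x] by (simp add: z_def)
  have 1: "((\<lambda>x. x\<^sup>2 / (1 - 4 * x) ^ 3) has_field_derivative ((2 * x
      + 4 * x\<^sup>2) / z ^ 4)) (at x)"
    using z unfolding z_def
    by (auto intro!: derivative_eq_intros simp: field_simps) algebra
  have 2: "((\<lambda>x. C * Y x ^ n) has_field_derivative C * (of_nat n * Y x ^ (n - Suc 0) * Y')) (at x)"
    if "(Y has_field_derivative Y') (at x)" for C Y' :: complex and Y
    using that by (auto intro!: derivative_eq_intros)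
  have "(sterm i n has_field_derivative
      of_nat (scoef n) * of_nat n ^ i * (of_nat n * t ^ (n - Suc 0) * ((2 * x
          + 4 * x\<^sup>2) / z ^ 4))) (at x)"
    unfolding sterm_def[abs_def] t_def z_def by (rule 2[OF 1[unfolded z_def]])
  then have "z * x * deriv (sterm i n) x =
      of_nat (scoef n) * of_nat n ^ i * (of_nat n * t ^ (n - Suc 0) * (z * x * ((2 * x
          + 4 * x\<^sup>2) / z ^ 4)))"
    by (simp add: DERIV_imp_deriv)
  also have "z * x * ((2 * x + 4 * x\<^sup>2) / z ^ 4) = t * (2 + 4 * x)"
    using z by (simp add: t_def field_simps power_numeral_reduce)
  also have "of_nat (scoef n) * of_nat n ^ i * (of_nat n * t ^ (n - Suc 0) * (t * (2 + 4 * x)))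
      = of_nat (scoef n) * of_nat n ^ i * (of_nat n * t ^ (n - Suc 0) * t) * (2 + 4 * x)"
    by (simp only: mult.assoc)
  also have "\<dots> = (2 + 4 * x) * sterm (Suc i) n x"
    unfolding power_minus_one_mult sterm_def t_def z_def by (simp add: mult_ac)
  finally show ?thesis by (simp add: z_def)
qed

lemma deriv_dmom:
  assumes x: "x \<in> disc"
  shows "(1 - 4 * x) * x * deriv (dmom i j) x = (1 - 4 * x) * dmom i (Suc j) x + dmom (Suc i) j x"
proof (rule sums_unique2)
  show "(\<lambda>n. (1 - 4 * x) * x * deriv (dterm i j n) x) sums ((1 - 4 * x) * x * deriv (dmom i j) x)"
    using x by (intro sums_mult dterm_sums deriv_dterm_sums)
  show "(\<lambda>n. (1 - 4 * x) * x * deriv (dterm i j n) x) sums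
      ((1 - 4 * x) * dmom i (Suc j) x + dmom (Suc i) j x)"
    unfolding deriv_dterm[OF x] using x by (intro sums_add sums_mult dterm_sums deriv_dterm_sums)
qed

lemma deriv_smom:
  assumes x: "x \<in> disc"
  shows "(1 - 4 * x) * x * deriv (smom i) x = (2 + 4 * x) * smom (Suc i) x"
proof (rule sums_unique2)
  show "(\<lambda>n. (1 - 4 * x) * x * deriv (sterm i n) x) sums ((1 - 4 * x) * x * deriv (smom i) x)"
    using x by (intro sums_mult sterm_sums deriv_sterm_sums)
  show "(\<lambda>n. (1 - 4 * x) * x * deriv (sterm i n) x) sums ((2 + 4 * x) * smom (Suc i) x)"
    unfolding deriv_sterm[OF x] using x by (intro sums_mult sterm_sums deriv_sterm_sums)
qed

section \<open>Relations between the moments\<close>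

lemma coef_Suc_right: "k \<le> n \<Longrightarrow> coef n (Suc k) * Suc k ^ 3 = coef n k * ((n + k + 1)
    * (n - k)\<^sup>2)"
proof -
  assume "k \<le> n"
  have 1: "(n choose Suc k) * Suc k = (n choose k) * (n - k)"
    by (metis binomial_absorption binomial_absorb_comp mult.commute)
  have 2: "(n + Suc k choose Suc k) * Suc k = Suc (n + k) * (n + k choose k)"
    by (metis Suc_times_binomial_eq add_Suc_right)
  have "coef n (Suc k) * Suc k ^ 3 =
      (2 * n choose n) * ((n choose Suc k) * Suc k)\<^sup>2 * ((n + Suc k choose Suc k) * Suc k)"
    by (simp only: coef_def power2_eq_square power3_eq_cube mult_ac)
  also have "\<dots> = coef n k * ((n + k + 1) * (n - k)\<^sup>2)"
    unfolding 1 2 coef_def power2_eq_square by (simp only: mult_ac Suc_eq_plus1 add_ac)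
  finally show ?thesis .
qed

lemma coef_Suc_left:
  "k \<le> n \<Longrightarrow> coef (Suc n) k * (Suc n - k)\<^sup>2 = coef n k * (2 * ((2 * n + 1) * (n + 1
      + k)))"
proof -
  assume "k \<le> n"
  have 1: "(Suc n choose k) * (Suc n - k) = Suc n * (n choose k)"
    using binomial_absorb_comp[of "Suc n" k] by (simp add: mult.commute)
  have 2: "(Suc n + k choose k) * Suc n = (Suc n + k) * (n + k choose k)"
    using binomial_absorb_comp[of "Suc n + k" k] by (simp add: mult.commute)
  have 3: "(2 * Suc n choose Suc n) * Suc n = 2 * (2 * n + 1) * (2 * n choose n)"
  proof -
    have "(2 * Suc n choose Suc n) * Suc n = 2 * Suc n * (2 * n + 1 choose n)"
      using Suc_times_binomial_eq[of "2 * n + 1" n] by simp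
    moreover have "Suc n * (2 * n + 1 choose n) = (2 * n + 1) * (2 * n choose n)"
      using binomial_absorb_comp[of "2 * n + 1" n] by simp
    ultimately show ?thesis by (metis mult.assoc)
  qed
  \<comment> \<open>The two additional factors \<open>Suc n\<close> are those required by facts 2
    and 3; they cancel at the end.\<close>
  have "(coef (Suc n) k * (Suc n - k)\<^sup>2) * (Suc n)\<^sup>2 =
      ((2 * Suc n choose Suc n) * Suc n) * ((Suc n choose k) * (Suc n - k))\<^sup>2 * ((Suc n
          + k choose k) * Suc n)"
    by (simp only: coef_def power2_eq_square mult_ac)
  also have "\<dots> = (coef n k * (2 * ((2 * n + 1) * (n + 1 + k)))) * (Suc n)\<^sup>2"
    unfolding 1 2 3 coef_def power2_eq_square by (simp only: mult_ac Suc_eq_plus1 add_ac)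
  finally show ?thesis by simp
qed

text \<open>The closed form \<open>(3n)! (2n)! / n!^5\<close>, free of division; the ratio of
  consecutive coefficients is read off from it.\<close>

lemma scoef_fact: "scoef n * fact n ^ 5 = (fact (3 * n) * fact (2 * n) :: nat)"
proof -
  have 1: "fact n * fact (2 * n) * (3 * n choose n) = (fact (3 * n) :: nat)"
    using binomial_fact_lemma[of n "3 * n"] by simp
  have 2: "fact n * fact n * (2 * n choose n) = (fact (2 * n) :: nat)"
    using binomial_fact_lemma[of n "2 * n"] by simp
  have "(scoef n * fact n ^ 5) * fact (2 * n) =
      (fact n * fact (2 * n) * (3 * n choose n)) * (fact n * fact n * (2 * n choose n))\<^sup>2"
    by (simp add: scoef_def power2_eq_square power_numeral_reduce mult_ac)
  also have "\<dots> = (fact (3 * n) * fact (2 * n)) * fact (2 * n)"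
    unfolding 1 2 by (simp add: power2_eq_square)
  finally show ?thesis by simp
qed

lemma scoef_Suc: "scoef (Suc n) * Suc n ^ 3 = 6 * (3 * n + 1) * (3 * n + 2) * (2 * n + 1) * scoef n"
proof -
  have 1: "fact (3 * Suc n) = (3 * n + 3) * (3 * n + 2) * (3 * n + 1) * (fact (3 * n) :: nat)"
  proof -
    have "3 * Suc n = Suc (Suc (Suc (3 * n)))" by simp
    then have "fact (3 * Suc n) = Suc (Suc (Suc (3 * n))) * (Suc (Suc (3 * n)) * (Suc (3 * n)
        * (fact (3 * n) :: nat)))"
      by (simp only: fact_Suc of_nat_id)
    also have "\<dots> = (3 * n + 3) * (3 * n + 2) * (3 * n + 1) * fact (3 * n)"
      by (simp only: Suc_eq_plus1 add.assoc mult_ac one_add_one) simp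
    finally show ?thesis .
  qed
  have 2: "fact (2 * Suc n) = (2 * n + 2) * (2 * n + 1) * (fact (2 * n) :: nat)"
    by (simp add: algebra_simps)
  have "(scoef (Suc n) * Suc n ^ 3) * (Suc n ^ 2 * fact n ^ 5) = scoef (Suc n) * fact (Suc n) ^ 5"
    by (simp add: power_mult_distrib power_add[symmetric] mult_ac del: mult_Suc mult_Suc_right power_Suc)
  also have "\<dots> = fact (3 * Suc n) * fact (2 * Suc n)"
    by (rule scoef_fact)
  also have "\<dots> = 6 * (3 * n + 1) * (3 * n + 2) * (2 * n + 1) * (fact (3 * n) * fact (2 * n)) * Suc n ^ 2"
    unfolding 1 2 power2_eq_square by (simp add: algebra_simps)
  also have "\<dots> = (6 * (3 * n + 1) * (3 * n + 2) * (2 * n + 1) * scoef n) * (Suc n ^ 2 * fact n ^ 5)"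
    unfolding scoef_fact[symmetric] by (simp only: mult_ac)
  finally show ?thesis by simp
qed

text \<open>A list of triples \<open>(c, i, j)\<close> encodes the polynomial
  \<open>\<Sum> c N\<^sup>i K\<^sup>j\<close>; \<open>dlin\<close> is the linear functional that replaces
  \<open>N\<^sup>i K\<^sup>j\<close> by the moment \<open>dmom i j\<close>.\<close>

definition peval :: "(int \<times> nat \<times> nat) list \<Rightarrow> complex \<Rightarrow> complex
    \<Rightarrow> complex" where
  "peval ps N K = (\<Sum>(c, i, j)\<leftarrow>ps. of_int c * (N ^ i * K ^ j))"

definition dlin :: "(int \<times> nat \<times> nat) list \<Rightarrow> complex \<Rightarrow> complex" where
  "dlin ps x = (\<Sum>(c, i, j)\<leftarrow>ps. of_int c * dmom i j x)"

lemma dlin_sums: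
  assumes "x \<in> disc"
  shows "(\<lambda>n. \<Sum>k\<le>n. of_nat (coef n k) * peval ps (of_nat n) (of_nat k) *
      (x ^ k * (x / (1 - 4 * x)) ^ n))
    sums dlin ps x"
proof (induction ps)
  case Nil
  then show ?case by (simp add: peval_def dlin_def)
next
  case (Cons p ps)
  obtain c i j where p: "p = (c, i, j)" by (cases p)
  have "(\<lambda>n. of_int c * dterm i j n x
      + (\<Sum>k\<le>n. of_nat (coef n k) * peval ps (of_nat n) (of_nat k) *
     (x ^ k * (x / (1 - 4 * x)) ^ n))) sums (of_int c * dmom i j x + dlin ps x)"
    using assms by (intro sums_add sums_mult dterm_sums Cons.IH)
  then show ?case
    by (simp add: dterm_def sum_distrib_left sum.distrib[symmetric] p peval_def dlin_def algebra_simps)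
qed

text \<open>The recurrence of \<open>coef\<close> in \<open>k\<close>, multiplied by an arbitrary
  \<open>q\<close> and summed: the index shift turns \<open>q N K\<close> into
  \<open>q N (K + 1)\<close> and releases one factor \<open>x\<close>. The factor
  \<open>K ^ 3\<close> removes the term \<open>k = 0\<close>, and \<open>coef n (Suc n) = 0\<close>
  closes the upper end.\<close>

lemma dlin_shift_right:
  assumes ps: "\<And>N K. peval ps N K = q N K * K ^ 3"
    and qs: "\<And>N K. peval qs N K = q N (K + 1) * ((N + K + 1) * (N - K)\<^sup>2)"
    and x: "x \<in> disc"
  shows "dlin ps x = x * dlin qs x"
proof (rule sums_unique2[OF dlin_sums[OF x]])
  define y where "y = x / (1 - 4 * x)"
  have eq: "(\<Sum>k\<le>n. of_nat (coef n k) * peval ps (of_nat n) (of_nat k) * (x ^ k * y ^ n)) =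
     x * (\<Sum>k\<le>n. of_nat (coef n k) * peval qs (of_nat n) (of_nat k) * (x ^ k * y ^ n))"
    (is "(\<Sum>k\<le>n. ?f k) = x * sum ?g _") for n
  proof -
    have "?f (Suc n) = 0" by (simp add: coef_def)
    then have "(\<Sum>k\<le>n. ?f k) = (\<Sum>k\<le>Suc n. ?f k)" by simp
    also have "\<dots> = ?f 0 + (\<Sum>k\<le>n. ?f (Suc k))" by (rule sum.atMost_Suc_shift)
    also have "?f 0 = 0" by (simp add: ps)
    also have "(\<Sum>k\<le>n. ?f (Suc k)) = (\<Sum>k\<le>n. x * ?g k)"
    proof (rule sum.cong[OF refl])
      fix k assume "k \<in> {..n}"
      then have k: "k \<le> n" by simp
      have "of_nat (coef n (Suc k)) * of_nat (Suc k) ^ 3 =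
          (of_nat (coef n k * ((n + k + 1) * (n - k)\<^sup>2)) :: complex)"
        unfolding coef_Suc_right[OF k, symmetric] by simp
      then have *: "of_nat (coef n (Suc k)) * of_nat (Suc k) ^ 3 =
          of_nat (coef n k) * ((of_nat n + of_nat k + 1) * (of_nat n - of_nat k :: complex)\<^sup>2)"
        by (simp only: of_nat_mult of_nat_add of_nat_power of_nat_diff[OF k] of_nat_1)
      have "?f (Suc k) = q (of_nat n) (of_nat (Suc k)) * (of_nat (coef n (Suc k)) * of_nat (Suc k) ^ 3) *
          (x ^ Suc k * y ^ n)"
        unfolding ps by (simp only: mult_ac)
      also have "\<dots> = x * ?g k"
        unfolding * qs by (simp add: mult_ac add_ac)
      finally show "?f (Suc k) = x * ?g k" .
    qed
    finally show ?thesis by (simp add: sum_distrib_left)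
  qed
  show "(\<lambda>n. \<Sum>k\<le>n. of_nat (coef n k) * peval ps (of_nat n) (of_nat k) *
      (x ^ k * (x / (1 - 4 * x)) ^ n))
      sums (x * dlin qs x)"
    unfolding eq[unfolded y_def] by (intro sums_mult dlin_sums x)
qed

lemma sums_drop_zero: "f sums s \<Longrightarrow> f 0 = 0 \<Longrightarrow> (\<lambda>n. f (Suc n)) sums s"
  for f :: "nat \<Rightarrow> 'a::real_normed_vector"
  by (simp add: sums_Suc_iff)

text \<open>The same device for the recurrence in \<open>n\<close>. Shifting \<open>n\<close>
  releases one factor \<open>x / (1 - 4 * x)\<close>, whose denominator is moved to the
  left.\<close>

lemma dlin_shift_left:
  assumes ps: "\<And>N K. peval ps N K = q N K * (N - K)\<^sup>2"
    and qs: "\<And>N K. peval qs N K = q (N + 1) K * ((2 * N + 1) * (N + 1 + K))"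
    and x: "x \<in> disc"
  shows "(1 - 4 * x) * dlin ps x = 2 * x * dlin qs x"
proof -
  define y where "y = x / (1 - 4 * x)"
  let ?f = "\<lambda>n. \<Sum>k\<le>n. of_nat (coef n k) * peval ps (of_nat n) (of_nat k) * (x ^ k * y ^ n)"
  let ?g = "\<lambda>n. \<Sum>k\<le>n. of_nat (coef n k) * peval qs (of_nat n) (of_nat k) * (x ^ k * y ^ n)"
  have eq: "?f (Suc n) = 2 * y * ?g n" for n
  proof -
    \<comment> \<open>The diagonal term \<open>k = Suc n\<close> drops out because of the factor
      \<open>(N - K)\<^sup>2\<close>; the same factor makes \<open>?f 0\<close> vanish
      below.\<close>
    have "?f (Suc n) = (\<Sum>k\<le>n. of_nat (coef (Suc n) k) * peval ps (of_nat (Suc n)) (of_nat k)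
        * (x ^ k * y ^ Suc n))"
      by (simp add: ps)
    also have "\<dots> = (\<Sum>k\<le>n. 2 * y * (of_nat (coef n k) * peval qs (of_nat n) (of_nat k)
        * (x ^ k * y ^ n)))"
    proof (rule sum.cong[OF refl])
      fix k assume "k \<in> {..n}"
      then have k: "k \<le> n" by simp
      have "of_nat (coef (Suc n) k * (Suc n - k)\<^sup>2) =
          (of_nat (coef n k * (2 * ((2 * n + 1) * (n + 1 + k)))) :: complex)"
        unfolding coef_Suc_left[OF k] ..
      then have *: "of_nat (coef (Suc n) k) * (of_nat (Suc n) - of_nat k)\<^sup>2 =
          of_nat (coef n k) * (2 * ((2 * of_nat n + 1) * (of_nat n + 1 + of_nat k :: complex)))"
        using of_nat_diff[OF le_SucI[OF k], where 'a = complex]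
        by (simp only: of_nat_mult of_nat_add of_nat_power of_nat_1 of_nat_numeral)
      have "of_nat (coef (Suc n) k) * peval ps (of_nat (Suc n)) (of_nat k) * (x ^ k * y ^ Suc n) =
         q (of_nat (Suc n)) (of_nat k) * (of_nat (coef (Suc n) k) * (of_nat (Suc n) - of_nat k)\<^sup>2)
             * (x ^ k * y ^ Suc n)"
        unfolding ps by (simp only: mult_ac)
      also have "\<dots> = 2 * y * (of_nat (coef n k) * peval qs (of_nat n) (of_nat k) * (x ^ k * y ^ n))"
        unfolding * qs by (simp add: mult_ac add_ac)
      finally show "of_nat (coef (Suc n) k) * peval ps (of_nat (Suc n)) (of_nat k) * (x ^ k * y ^ Suc n)
          = \<dots>" .
    qed
    finally show ?thesis by (simp add: sum_distrib_left)
  qed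
  have "?f sums dlin ps x"
    unfolding y_def by (rule dlin_sums[OF x])
  moreover have "?f 0 = 0" by (simp add: ps)
  ultimately have "(\<lambda>n. ?f (Suc n)) sums dlin ps x"
    by (rule sums_drop_zero)
  moreover have "(\<lambda>n. ?f (Suc n)) sums (2 * y * dlin qs x)"
    unfolding eq unfolding y_def by (intro sums_mult dlin_sums x)
  ultimately have "dlin ps x = 2 * y * dlin qs x"
    by (rule sums_unique2)
  then show ?thesis
    using disc_bounds[OF x] by (simp add: y_def)
qed

text \<open>Summation of \<open>scoef_Suc\<close>, using
  \<open>(3n + 1)(3n + 2)(2n + 1) = 18n^3 + 27n^2 + 13n + 2\<close>.\<close>

lemma smom_recurrence:
  assumes x: "x \<in> disc"
  shows "(1 - 4 * x) ^ 3 * smom 3 x = 6 * x\<^sup>2 * (18 * smom 3 x + 27 * smom 2 x + 13 * smom 1 x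
      + 2 * smom 0 x)"
proof -
  define t where "t = x\<^sup>2 / (1 - 4 * x) ^ 3"
  have eq: "sterm 3 (Suc n) x = t * (6 * (18 * sterm 3 n x + 27 * sterm 2 n x + 13 * sterm 1 n x
      + 2 * sterm 0 n x))" for n
  proof -
    have "sterm 3 (Suc n) x = of_nat (scoef (Suc n) * Suc n ^ 3) * t ^ Suc n"
      by (simp add: sterm_def t_def)
    also have "\<dots> = t * (6 * (18 * sterm 3 n x + 27 * sterm 2 n x + 13 * sterm 1 n x + 2 * sterm 0 n x))"
      unfolding scoef_Suc sterm_def t_def[symmetric]
      by (simp add: algebra_simps power2_eq_square power3_eq_cube)
    finally show ?thesis .
  qed
  have "(\<lambda>n. sterm 3 n x) sums smom 3 x" by (rule sterm_sums[OF x])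
  moreover have "sterm 3 0 x = 0" by (simp add: sterm_def)
  ultimately have "(\<lambda>n. sterm 3 (Suc n) x) sums smom 3 x"
    by (rule sums_drop_zero)
  moreover have "(\<lambda>n. sterm 3 (Suc n) x) sums
      (t * (6 * (18 * smom 3 x + 27 * smom 2 x + 13 * smom 1 x + 2 * smom 0 x)))"
    unfolding eq by (intro sums_mult sums_add sterm_sums[OF x])
  ultimately have "smom 3 x = t * (6 * (18 * smom 3 x + 27 * smom 2 x + 13 * smom 1 x + 2 * smom 0 x))"
    by (rule sums_unique2)
  then show ?thesis
    using disc_bounds(3)[OF x] by (simp add: t_def field_simps)
qed

section \<open>Passage to formal power series at 0\<close>

definition theta :: "complex fps \<Rightarrow> complex fps" where
  "theta f = (1 - 4 * fps_X) * fps_X * fps_deriv f"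

definition dfps :: "nat \<Rightarrow> nat \<Rightarrow> complex fps" where
  "dfps i j = fps_expansion (dmom i j) 0"

definition sfps :: "nat \<Rightarrow> complex fps" where
  "sfps i = fps_expansion (smom i) 0"

definition rsqrt :: "complex \<Rightarrow> complex" where
  "rsqrt x = 1 / csqrt (1 - 4 * x)"

definition rfps :: "complex fps" where
  "rfps = fps_expansion rsqrt 0"

text \<open>A positive real part keeps \<open>1 - 4 * x\<close> off the branch cut of
  \<open>csqrt\<close>, so \<open>rsqrt\<close> is holomorphic on the disc.\<close>

lemma disc_not_nonpos:
  assumes "x \<in> disc"
  shows "1 - 4 * x \<notin> \<real>\<^sub>\<le>\<^sub>0"
proof -
  have "Re x \<le> norm x" by (rule complex_Re_le_cmod)
  then have "Re (1 - 4 * x) > 0" using disc_bounds(1)[OF assms] by simp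
  then show ?thesis by (auto simp: complex_nonpos_Reals_iff)
qed

lemma dmom_fps: "dmom i j has_fps_expansion dfps i j"
  unfolding dfps_def using dmom_holomorphic by (intro has_fps_expansion_fps_expansion[of disc]) auto

lemma smom_fps: "smom i has_fps_expansion sfps i"
  unfolding sfps_def using smom_holomorphic by (intro has_fps_expansion_fps_expansion[of disc]) auto

lemma rsqrt_fps: "rsqrt has_fps_expansion rfps"
  unfolding rfps_def
proof (rule has_fps_expansion_fps_expansion[of disc])
  show "rsqrt holomorphic_on disc"
    unfolding rsqrt_def[abs_def] using disc_not_nonpos disc_bounds(3)
    by (intro holomorphic_intros) auto
qed auto

text \<open>Uniqueness of the expansion at 0. Every analytic relation proved on the disc is carried
  over to formal power series through this lemma.\<close>

lemma fps_eq_if_eq_on_disc: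
  assumes "f has_fps_expansion F" "g has_fps_expansion G" "\<And>x. x \<in> disc \<Longrightarrow> f x = g x"
  shows "F = G"
proof -
  have "eventually (\<lambda>x. f x = g x) (nhds 0)"
    using eventually_nhds_in_open[OF open_disc zero_in_disc] by eventually_elim (rule assms(3))
  then have "f has_fps_expansion G"
    using assms(2) has_fps_expansion_cong by blast
  then show ?thesis
    using assms(1) fps_expansion_unique_complex by blast
qed

lemma theta_dfps: "theta (dfps i j) = (1 - 4 * fps_X) * dfps i (Suc j) + dfps (Suc i) j"
  unfolding theta_def
  by (rule fps_eq_if_eq_on_disc[where f = "\<lambda>x. (1 - 4 * x) * x * deriv (dmom i j) x",
        OF _ _ deriv_dmom])
     (intro fps_expansion_intros dmom_fps)+

lemma theta_sfps: "theta (sfps i) = (2 + 4 * fps_X) * sfps (Suc i)"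
  unfolding theta_def
  by (rule fps_eq_if_eq_on_disc[where f = "\<lambda>x. (1 - 4 * x) * x * deriv (smom i) x", OF _ _ deriv_smom])
     (intro fps_expansion_intros smom_fps)+

lemma deriv_rsqrt:
  assumes x: "x \<in> disc"
  shows "(1 - 4 * x) * x * deriv rsqrt x = 2 * x * rsqrt x"
proof -
  define s where "s = csqrt (1 - 4 * x)"
  have s: "s\<^sup>2 = 1 - 4 * x" by (simp add: s_def)
  then have "s \<noteq> 0" using disc_bounds(3)[OF x] by auto
  have "(rsqrt has_field_derivative (2 / s) / s\<^sup>2) (at x)"
    unfolding rsqrt_def[abs_def] s_def using disc_not_nonpos[OF x] disc_bounds(3)[OF x]
    by (auto intro!: derivative_eq_intros simp: power2_eq_square)
  then have "deriv rsqrt x = (2 / s) / s\<^sup>2" by (rule DERIV_imp_deriv)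
  then show ?thesis
    using \<open>s \<noteq> 0\<close> unfolding s[symmetric] by (simp add: rsqrt_def s_def[symmetric])
qed

lemma theta_rfps: "theta rfps = 2 * fps_X * rfps"
  unfolding theta_def
  by (rule fps_eq_if_eq_on_disc[where f = "\<lambda>x. (1 - 4 * x) * x * deriv rsqrt x",
        OF _ _ deriv_rsqrt])
     (intro fps_expansion_intros rsqrt_fps)+

lemma sfps_recurrence:
  "(1 - 4 * fps_X) ^ 3 * sfps 3 = 6 * fps_X\<^sup>2 * (18 * sfps 3 + 27 * sfps 2 + 13 * sfps 1 + 2 * sfps 0)"
  by (rule fps_eq_if_eq_on_disc[where f = "\<lambda>x. (1 - 4 * x) ^ 3 * smom 3 x",
        OF _ _ smom_recurrence])
     (intro fps_expansion_intros smom_fps)+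

definition flin :: "(int \<times> nat \<times> nat) list \<Rightarrow> complex fps" where
  "flin ps = (\<Sum>(c, i, j)\<leftarrow>ps. of_int c * dfps i j)"

lemma dlin_fps: "dlin ps has_fps_expansion flin ps"
proof (induction ps)
  case Nil
  then show ?case by (simp add: dlin_def[abs_def] flin_def)
next
  case (Cons p ps)
  obtain c i j where p: "p = (c, i, j)" by (cases p)
  have "(\<lambda>x. of_int c * dmom i j x + dlin ps x) has_fps_expansion (fps_const (of_int c) * dfps i j
      + flin ps)"
    by (intro fps_expansion_intros dmom_fps Cons.IH)
  then show ?case by (simp add: p dlin_def[abs_def] flin_def fps_of_int)
qed

lemma flin_shift_right:
  assumes "\<And>N K. peval ps N K = q N K * K ^ 3"
    and "\<And>N K. peval qs N K = q N (K + 1) * ((N + K + 1) * (N - K)\<^sup>2)"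
  shows "flin ps = fps_X * flin qs"
  by (rule fps_eq_if_eq_on_disc[where f = "dlin ps", OF _ _ dlin_shift_right[of ps q qs, OF assms]])
     (intro fps_expansion_intros dlin_fps)+

lemma flin_shift_left:
  assumes "\<And>N K. peval ps N K = q N K * (N - K)\<^sup>2"
    and "\<And>N K. peval qs N K = q (N + 1) K * ((2 * N + 1) * (N + 1 + K))"
  shows "(1 - 4 * fps_X) * flin ps = 2 * fps_X * flin qs"
  by (rule fps_eq_if_eq_on_disc[where f = "\<lambda>x. (1 - 4 * x) * dlin ps x",
        OF _ _ dlin_shift_left[of ps q qs, OF assms]])
     (intro fps_expansion_intros dlin_fps)+

text \<open>In this and the next eight lemmas the suffix \<open>ij\<close> records the multiplier
  \<open>q N K = N ^ i * K ^ j\<close>. The second list is the expanded polynomial on the shifted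
  side of the recurrence.\<close>

lemma dfps_shift_right_00:
  "dfps 0 3 =
    fps_X * (dfps 3 0 - dfps 2 1 - dfps 1 2 + dfps 0 3 + dfps 2 0 - 2 * dfps 1 1 + dfps 0 2)"
  using flin_shift_right[of "[(1, 0, 3)]" "\<lambda>N K. 1"
      "[(1, 3, 0), (-1, 2, 1), (-1, 1, 2), (1, 0, 3), (1, 2, 0), (-2, 1, 1), (1, 0, 2)]"]
  by (simp add: flin_def peval_def algebra_simps power_numeral_reduce)

lemma dfps_shift_right_10:
  "dfps 1 3 =
    fps_X * (dfps 4 0 - dfps 3 1 - dfps 2 2 + dfps 1 3 + dfps 3 0 - 2 * dfps 2 1 + dfps 1 2)"
  using flin_shift_right[of "[(1, 1, 3)]" "\<lambda>N K. N"
      "[(1, 4, 0), (-1, 3, 1), (-1, 2, 2), (1, 1, 3), (1, 3, 0), (-2, 2, 1), (1, 1, 2)]"]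
  by (simp add: flin_def peval_def algebra_simps power_numeral_reduce)

lemma dfps_shift_right_01:
  "dfps 0 4 =
    fps_X * (dfps 3 1 - dfps 2 2 - dfps 1 3 + dfps 0 4 + dfps 3 0 - 3 * dfps 1 2 + 2 * dfps 0 3 + dfps 2 0
        - 2 * dfps 1 1 + dfps 0 2)"
  using flin_shift_right[of "[(1, 0, 4)]" "\<lambda>N K. K"
      "[(1, 3, 1), (-1, 2, 2), (-1, 1, 3), (1, 0, 4), (1, 3, 0), (-3, 1, 2), (2, 0, 3), (1, 2, 0),
       (-2, 1, 1), (1, 0, 2)]"]
  by (simp add: flin_def peval_def algebra_simps power_numeral_reduce)

lemma dfps_shift_left_00:
  "(1 - 4 * fps_X) * (dfps 2 0 - 2 * dfps 1 1 + dfps 0 2) =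
    2 * fps_X * (2 * dfps 2 0 + 2 * dfps 1 1 + 3 * dfps 1 0 + dfps 0 1 + dfps 0 0)"
  using flin_shift_left[of "[(1, 2, 0), (-2, 1, 1), (1, 0, 2)]" "\<lambda>N K. 1"
      "[(2, 2, 0), (2, 1, 1), (3, 1, 0), (1, 0, 1), (1, 0, 0)]"]
  by (simp add: flin_def peval_def algebra_simps power_numeral_reduce)

lemma dfps_shift_left_10:
  "(1 - 4 * fps_X) * (dfps 3 0 - 2 * dfps 2 1 + dfps 1 2) =
    2 * fps_X * (2 * dfps 3 0 + 2 * dfps 2 1 + 5 * dfps 2 0 + 3 * dfps 1 1 + 4 * dfps 1 0 + dfps 0 1
        + dfps 0 0)"
  using flin_shift_left[of "[(1, 3, 0), (-2, 2, 1), (1, 1, 2)]" "\<lambda>N K. N"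
      "[(2, 3, 0), (2, 2, 1), (5, 2, 0), (3, 1, 1), (4, 1, 0), (1, 0, 1), (1, 0, 0)]"]
  by (simp add: flin_def peval_def algebra_simps power_numeral_reduce)

lemma dfps_shift_left_01:
  "(1 - 4 * fps_X) * (dfps 2 1 - 2 * dfps 1 2 + dfps 0 3) =
    2 * fps_X * (2 * dfps 2 1 + 2 * dfps 1 2 + 3 * dfps 1 1 + dfps 0 2 + dfps 0 1)"
  using flin_shift_left[of "[(1, 2, 1), (-2, 1, 2), (1, 0, 3)]" "\<lambda>N K. K"
      "[(2, 2, 1), (2, 1, 2), (3, 1, 1), (1, 0, 2), (1, 0, 1)]"]
  by (simp add: flin_def peval_def algebra_simps power_numeral_reduce)

lemma dfps_shift_left_20:
  "(1 - 4 * fps_X) * (dfps 4 0 - 2 * dfps 3 1 + dfps 2 2) =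
    2 * fps_X * (2 * dfps 4 0 + 2 * dfps 3 1 + 7 * dfps 3 0 + 5 * dfps 2 1 + 9 * dfps 2 0 + 4 * dfps 1 1
        + 5 * dfps 1 0 + dfps 0 1 + dfps 0 0)"
  using flin_shift_left[of "[(1, 4, 0), (-2, 3, 1), (1, 2, 2)]" "\<lambda>N K. N\<^sup>2"
      "[(2, 4, 0), (2, 3, 1), (7, 3, 0), (5, 2, 1), (9, 2, 0), (4, 1, 1), (5, 1, 0), (1, 0, 1), (1, 0, 0)]"]
  by (simp add: flin_def peval_def algebra_simps power_numeral_reduce)

lemma dfps_shift_left_11:
  "(1 - 4 * fps_X) * (dfps 3 1 - 2 * dfps 2 2 + dfps 1 3) =
    2 * fps_X * (2 * dfps 3 1 + 2 * dfps 2 2 + 5 * dfps 2 1 + 3 * dfps 1 2 + 4 * dfps 1 1 + dfps 0 2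
        + dfps 0 1)"
  using flin_shift_left[of "[(1, 3, 1), (-2, 2, 2), (1, 1, 3)]" "\<lambda>N K. N * K"
      "[(2, 3, 1), (2, 2, 2), (5, 2, 1), (3, 1, 2), (4, 1, 1), (1, 0, 2), (1, 0, 1)]"]
  by (simp add: flin_def peval_def algebra_simps power_numeral_reduce)

lemma dfps_shift_left_02:
  "(1 - 4 * fps_X) * (dfps 2 2 - 2 * dfps 1 3 + dfps 0 4) =
    2 * fps_X * (2 * dfps 2 2 + 2 * dfps 1 3 + 3 * dfps 1 2 + dfps 0 3 + dfps 0 2)"
  using flin_shift_left[of "[(1, 2, 2), (-2, 1, 3), (1, 0, 4)]" "\<lambda>N K. K\<^sup>2"
      "[(2, 2, 2), (2, 1, 3), (3, 1, 2), (1, 0, 3), (1, 0, 2)]"]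
  by (simp add: flin_def peval_def algebra_simps power_numeral_reduce)

section \<open>Differential equations for the power series\<close>

text \<open>In the form "difference equals 0", so that any combination of the relations simplifies
  to 0.\<close>

lemmas dfps_shift_diffs = dfps_shift_right_00[THEN right_minus_eq[THEN iffD2]]
  dfps_shift_right_10[THEN right_minus_eq[THEN iffD2]]
  dfps_shift_right_01[THEN right_minus_eq[THEN iffD2]]
  dfps_shift_left_00[THEN right_minus_eq[THEN iffD2]]
  dfps_shift_left_10[THEN right_minus_eq[THEN iffD2]]
  dfps_shift_left_01[THEN right_minus_eq[THEN iffD2]]
  dfps_shift_left_20[THEN right_minus_eq[THEN iffD2]]
  dfps_shift_left_11[THEN right_minus_eq[THEN iffD2]]
  dfps_shift_left_02[THEN right_minus_eq[THEN iffD2]]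

lemma theta_simps [simp]:
  "theta (f + g) = theta f + theta g" "theta (f - g) = theta f - theta g"
  "theta (f * g) = theta f * g + f * theta g" "theta fps_X = (1 - 4 * fps_X) * fps_X"
  "theta (- f) = - theta f" "theta 0 = 0" "theta 1 = 0" "theta (numeral k) = 0"
  by (simp_all add: theta_def algebra_simps)

text \<open>To lowest order \<open>1 - 4 * fps_X\<close> acts as 1, so \<open>theta\<close> acts on
  the leading coefficient like \<open>x d/dx\<close>, multiplying it by its degree.\<close>

lemma theta_nth:
  assumes "\<forall>m<n. fps_nth f m = 0"
  shows "\<forall>m<n. fps_nth (theta f) m = 0" "fps_nth (theta f) n = of_nat n * fps_nth f n"
proof -
  have *: "theta f = fps_X * fps_deriv f - 4 * (fps_X * (fps_X * fps_deriv f))"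
    by (simp add: theta_def algebra_simps)
  have X: "fps_nth (fps_X * fps_deriv f) m = of_nat m * fps_nth f m" for m
    by (cases m) (simp_all add: fps_X_mult_nth)
  have 4: "fps_nth (4 * g) m = 4 * fps_nth g m" for g :: "complex fps" and m
    by (simp add: numeral_fps_const)
  have nth: "fps_nth (theta f) m = of_nat m * fps_nth f m -
      4 * (if m = 0 then 0 else of_nat (m - 1) * fps_nth f (m - 1))" for m
    unfolding * fps_sub_nth 4 fps_X_mult_nth[of "fps_X * fps_deriv f"] X ..
  show "\<forall>m<n. fps_nth (theta f) m = 0" "fps_nth (theta f) n = of_nat n * fps_nth f n"
    using assms by (auto simp: nth)
qed

lemma fps_mult_nth_lowest:
  fixes f p :: "'a::comm_ring_1 fps"
  assumes "\<forall>m<n. fps_nth f m = 0"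
  shows "fps_nth (p * f) n = fps_nth p 0 * fps_nth f n"
proof -
  have "fps_nth (f * p) n = (\<Sum>i=0..n. fps_nth f i * fps_nth p (n - i))"
    by (rule fps_mult_nth)
  also have "\<dots> = (\<Sum>i\<in>{n}. fps_nth f i * fps_nth p (n - i))"
    using assms by (intro sum.mono_neutral_right) auto
  finally show ?thesis by (simp add: mult.commute)
qed

text \<open>The lowest coefficient of a power series solution is annihilated by the indicial polynomial.\<close>

lemma theta_equation_trivial:
  assumes eq: "p3 * theta (theta (theta f)) + p2 * theta (theta f) + p1 * theta f + p0 * f = 0"
    and indicial: "\<And>n. n \<ge> r \<Longrightarrow> fps_nth p3 0 * of_nat n ^ 3
        + fps_nth p2 0 * of_nat n ^ 2 +
      fps_nth p1 0 * of_nat n + fps_nth p0 0 \<noteq> 0"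
    and init: "\<And>n. n < r \<Longrightarrow> fps_nth f n = 0"
  shows "f = 0"
proof (rule fps_ext)
  fix n
  show "fps_nth f n = fps_nth 0 n"
  proof (induction n rule: less_induct)
    case (less n)
    then have 0: "\<forall>m<n. fps_nth f m = 0" by simp
    note 1 = theta_nth[OF 0]
    note 2 = theta_nth[OF 1(1)]
    note 3 = theta_nth[OF 2(1)]
    have "fps_nth (p3 * theta (theta (theta f)) + p2 * theta (theta f) + p1 * theta f + p0 * f) n =
        (fps_nth p3 0 * of_nat n ^ 3 + fps_nth p2 0 * of_nat n ^ 2 + fps_nth p1 0 * of_nat n
            + fps_nth p0 0) * fps_nth f n"
      unfolding fps_add_nth fps_mult_nth_lowest[OF 0] fps_mult_nth_lowest[OF 1(1)]
        fps_mult_nth_lowest[OF 2(1)] fps_mult_nth_lowest[OF 3(1)] 1(2) 2(2) 3(2)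
      by (simp add: algebra_simps power2_eq_square power3_eq_cube)
    then show ?case
      using eq indicial[of n] init[of n] by (cases "n < r") auto
  qed
qed

section \<open>Vanishing of the satellite combination\<close>

text \<open>The expansion of \<open>E\<close>. Its vanishing is the additional relation that
  expresses \<open>dfps 0 1\<close> through \<open>dfps 1 0\<close> and
  \<open>dfps 0 0\<close>.\<close>

definition satellite :: "complex fps" where
  "satellite = (1 - 6 * fps_X) * dfps 1 0 - 2 * (1 - fps_X) * dfps 0 1 - 2 * fps_X * dfps 0 0"

lemma theta_X_power [simp]: "theta (fps_X ^ n) = of_nat n * (1 - 4 * fps_X) * fps_X ^ n"
proof (induction n)
  case (Suc n)
  then have "theta (fps_X ^ Suc n) =
      (1 - 4 * fps_X) * fps_X * fps_X ^ n + fps_X * (of_nat n * (1 - 4 * fps_X) * fps_X ^ n)"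
    by simp
  then show ?case by (simp add: algebra_simps)
qed simp

lemma nat_numeral_Suc: "Suc 0 = 1" "Suc 1 = 2" "Suc 2 = 3" "Suc 3 = 4"
  by simp_all

text \<open>This and the following expansions apply only the product rule and
  \<open>theta_dfps\<close>. They write iterates of \<open>theta\<close> as polynomial combinations
  of moments, a form in which membership in the span of the shift relations is a polynomial
  identity.\<close>

lemma theta_satellite1:
  "theta satellite =
    (1 - 6 * fps_X) * dfps 2 0 +
    (- 1 - 8 * fps_X + 24 * fps_X ^ 2) * dfps 1 1 +
    (- 2 + 10 * fps_X - 8 * fps_X ^ 2) * dfps 0 2 +
    (- 8 * fps_X + 24 * fps_X ^ 2) * dfps 1 0 +
    (- 2 * fps_X + 8 * fps_X ^ 2) * dfps 0 0"
  unfolding satellite_def theta_simps theta_dfps nat_numeral_Suc by algebra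

lemma theta_satellite2:
  "theta (theta satellite) =
    (1 - 6 * fps_X) * dfps 3 0 +
    (- 18 * fps_X + 48 * fps_X ^ 2) * dfps 2 1 +
    (- 3 + 6 * fps_X + 48 * fps_X ^ 2 - 96 * fps_X ^ 3) * dfps 1 2 +
    (- 2 + 18 * fps_X - 48 * fps_X ^ 2 + 32 * fps_X ^ 3) * dfps 0 3 +
    (- 14 * fps_X + 48 * fps_X ^ 2) * dfps 2 0 +
    (- 16 * fps_X + 136 * fps_X ^ 2 - 288 * fps_X ^ 3) * dfps 1 1 +
    (10 * fps_X - 56 * fps_X ^ 2 + 64 * fps_X ^ 3) * dfps 0 2 +
    (- 10 * fps_X + 88 * fps_X ^ 2 - 192 * fps_X ^ 3) * dfps 1 0 +
    (- 2 * fps_X + 16 * fps_X ^ 2 - 32 * fps_X ^ 3) * dfps 0 1 +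
    (- 2 * fps_X + 24 * fps_X ^ 2 - 64 * fps_X ^ 3) * dfps 0 0"
  unfolding theta_satellite1 theta_simps theta_X_power of_nat_numeral theta_dfps nat_numeral_Suc by algebra

lemma theta_satellite3:
  "theta (theta (theta satellite)) =
    (1 - 6 * fps_X) * dfps 4 0 +
    (1 - 28 * fps_X + 72 * fps_X ^ 2) * dfps 3 1 +
    (- 3 - 12 * fps_X + 168 * fps_X ^ 2 - 288 * fps_X ^ 3) * dfps 2 2 +
    (- 5 + 36 * fps_X - 24 * fps_X ^ 2 - 256 * fps_X ^ 3 + 384 * fps_X ^ 4) * dfps 1 3 +
    (- 2 + 26 * fps_X - 120 * fps_X ^ 2 + 224 * fps_X ^ 3 - 128 * fps_X ^ 4) * dfps 0 4 +
    (- 20 * fps_X + 72 * fps_X ^ 2) * dfps 3 0 +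
    (- 48 * fps_X + 408 * fps_X ^ 2 - 864 * fps_X ^ 3) * dfps 2 1 +
    (216 * fps_X ^ 2 - 1440 * fps_X ^ 3 + 2304 * fps_X ^ 4) * dfps 1 2 +
    (28 * fps_X - 264 * fps_X ^ 2 + 768 * fps_X ^ 3 - 640 * fps_X ^ 4) * dfps 0 3 +
    (- 24 * fps_X + 240 * fps_X ^ 2 - 576 * fps_X ^ 3) * dfps 2 0 +
    (- 28 * fps_X + 480 * fps_X ^ 2 - 2528 * fps_X ^ 3 + 4224 * fps_X ^ 4) * dfps 1 1 +
    (8 * fps_X - 128 * fps_X ^ 2 + 544 * fps_X ^ 3 - 640 * fps_X ^ 4) * dfps 0 2 +
    (- 12 * fps_X + 240 * fps_X ^ 2 - 1344 * fps_X ^ 3 + 2304 * fps_X ^ 4) * dfps 1 0 +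
    (- 4 * fps_X + 72 * fps_X ^ 2 - 384 * fps_X ^ 3 + 640 * fps_X ^ 4) * dfps 0 1 +
    (- 2 * fps_X + 56 * fps_X ^ 2 - 384 * fps_X ^ 3 + 768 * fps_X ^ 4) * dfps 0 0"
  unfolding theta_satellite2 theta_simps theta_X_power of_nat_numeral theta_dfps nat_numeral_Suc by algebra

lemma theta_dfps_00_1:
  "theta (dfps 0 0) =
    dfps 1 0 +
    (1 - 4 * fps_X) * dfps 0 1"
  unfolding theta_simps theta_dfps nat_numeral_Suc by algebra

lemma theta_dfps_00_2:
  "theta (theta (dfps 0 0)) =
    dfps 2 0 +
    (2 - 8 * fps_X) * dfps 1 1 +
    (1 - 8 * fps_X + 16 * fps_X ^ 2) * dfps 0 2 +
    (- 4 * fps_X + 16 * fps_X ^ 2) * dfps 0 1"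
  unfolding theta_dfps_00_1 theta_simps theta_X_power of_nat_numeral theta_dfps nat_numeral_Suc by algebra

lemma theta_dfps_00_3:
  "theta (theta (theta (dfps 0 0))) =
    dfps 3 0 +
    (3 - 12 * fps_X) * dfps 2 1 +
    (3 - 24 * fps_X + 48 * fps_X ^ 2) * dfps 1 2 +
    (1 - 12 * fps_X + 48 * fps_X ^ 2 - 64 * fps_X ^ 3) * dfps 0 3 +
    (- 12 * fps_X + 48 * fps_X ^ 2) * dfps 1 1 +
    (- 12 * fps_X + 96 * fps_X ^ 2 - 192 * fps_X ^ 3) * dfps 0 2 +
    (- 4 * fps_X + 48 * fps_X ^ 2 - 128 * fps_X ^ 3) * dfps 0 1"
  unfolding theta_dfps_00_2 theta_simps theta_X_power of_nat_numeral theta_dfps nat_numeral_Suc by algebra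

text \<open>The cofactors of the shift relations come from solving a linear system over the field of
  rational functions in \<open>x\<close>.\<close>

lemma theta_satellite:
  "theta (theta (theta satellite)) + (14 * fps_X - 1) * theta (theta satellite) +
    (2 * fps_X + 24 * fps_X ^ 2) * theta satellite + 8 * fps_X ^ 2 * satellite = 0" (is "?lhs = 0")
proof -
  have "?lhs =
      (4 - 32 * fps_X + 64 * fps_X ^ 2 - 32 * fps_X ^ 3) * (dfps 0 3 - fps_X * (dfps 3 0 - dfps 2 1
          - dfps 1 2 + dfps 0 3 + dfps 2 0 - 2 * dfps 1 1 + dfps 0 2)) +
      (- 4 + 16 * fps_X + 16 * fps_X ^ 2 - 128 * fps_X ^ 3) * (dfps 1 3 - fps_X * (dfps 4 0 - dfps 3 1
          - dfps 2 2 + dfps 1 3 + dfps 3 0 - 2 * dfps 2 1 + dfps 1 2)) +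
      (- 4 + 48 * fps_X - 176 * fps_X ^ 2 + 192 * fps_X ^ 3) * (dfps 0 4 - fps_X * (dfps 3 1 - dfps 2 2
          - dfps 1 3 + dfps 0 4 + dfps 3 0 - 3 * dfps 1 2 + 2 * dfps 0 3 + dfps 2 0 - 2 * dfps 1 1
          + dfps 0 2)) +
      (8 * fps_X ^ 2 - 16 * fps_X ^ 3) * ((1 - 4 * fps_X) * (dfps 2 0 - 2 * dfps 1 1 + dfps 0 2)
          - 2 * fps_X * (2 * dfps 2 0 + 2 * dfps 1 1 + 3 * dfps 1 0 + dfps 0 1 + dfps 0 0)) +
      (- 1 + 2 * fps_X + 8 * fps_X ^ 2 - 32 * fps_X ^ 3) * ((1 - 4 * fps_X) * (dfps 3 0 - 2 * dfps 2 1
          + dfps 1 2) - 2 * fps_X * (2 * dfps 3 0 + 2 * dfps 2 1 + 5 * dfps 2 0 + 3 * dfps 1 1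
          + 4 * dfps 1 0 + dfps 0 1 + dfps 0 0)) +
      (- 2 + 6 * fps_X + 24 * fps_X ^ 2 - 32 * fps_X ^ 3) * ((1 - 4 * fps_X) * (dfps 2 1 - 2 * dfps 1 2
          + dfps 0 3) - 2 * fps_X * (2 * dfps 2 1 + 2 * dfps 1 2 + 3 * dfps 1 1 + dfps 0 2 + dfps 0 1)) +
      (1 - 2 * fps_X + 16 * fps_X ^ 3) * ((1 - 4 * fps_X) * (dfps 4 0 - 2 * dfps 3 1 + dfps 2 2)
          - 2 * fps_X * (2 * dfps 4 0 + 2 * dfps 3 1 + 7 * dfps 3 0 + 5 * dfps 2 1 + 9 * dfps 2 0
          + 4 * dfps 1 1 + 5 * dfps 1 0 + dfps 0 1 + dfps 0 0)) +
      (3 - 12 * fps_X + 16 * fps_X ^ 2 - 32 * fps_X ^ 3) * ((1 - 4 * fps_X) * (dfps 3 1 - 2 * dfps 2 2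
          + dfps 1 3) - 2 * fps_X * (2 * dfps 3 1 + 2 * dfps 2 2 + 5 * dfps 2 1 + 3 * dfps 1 2
          + 4 * dfps 1 1 + dfps 0 2 + dfps 0 1)) +
      (2 - 18 * fps_X + 32 * fps_X ^ 2 - 16 * fps_X ^ 3) * ((1 - 4 * fps_X) * (dfps 2 2 - 2 * dfps 1 3
          + dfps 0 4) - 2 * fps_X * (2 * dfps 2 2 + 2 * dfps 1 3 + 3 * dfps 1 2 + dfps 0 3 + dfps 0 2))"
    unfolding theta_satellite3 unfolding theta_satellite2 unfolding theta_satellite1
    unfolding satellite_def by algebra
  also have "\<dots> = 0"
    by (simp only: dfps_shift_diffs mult_zero_right add_0_right)
  finally show ?thesis .
qed

lemma dfps_nth_0: "fps_nth (dfps i j) 0 = (if i = 0 \<and> j = 0 then 1 else 0)"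
proof -
  have "(\<lambda>n. dterm i j n 0) = (\<lambda>n. if n = 0 then if i = 0 \<and> j = 0 then 1 else 0 else 0)"
    by (auto simp: dterm_def coef_def power_0_left)
  then have "dmom i j 0 = (if i = 0 \<and> j = 0 then 1 else 0)"
    unfolding dmom_def using sums_unique[OF sums_single[of 0 "\<lambda>_. if i = 0 \<and> j
        = 0 then 1 else (0::complex)"]] by simp
  then show ?thesis
    using has_fps_expansion_imp_0_eq_fps_nth_0[OF dmom_fps[of i j]] by simp
qed

lemma fps_numeral_mult_nth [simp]: "fps_nth (numeral k * f) n = numeral k * fps_nth f n"
  for f :: "complex fps"
  by (simp add: numeral_fps_const)

text \<open>The indicial roots 0, 0 and 1 leave the first two coefficients to be checked. The linear
  coefficients of the moments are obtained from the relations already proved, without expanding the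
  series.\<close>

lemma satellite_nth:
  assumes "n < 2"
  shows "fps_nth satellite n = 0"
proof -
  define a where "a i j = fps_nth (dfps i j) 1" for i j
  have mult: "fps_nth ((1 - 4 * fps_X) * f) 1 = fps_nth f 1 - 4 * fps_nth f 0"
    "fps_nth (fps_X * f) 1 = fps_nth f 0" "fps_nth (2 * fps_X * f) 1 = 2 * fps_nth f 0" for f :: "complex fps"
    by (simp_all add: left_diff_distrib mult.assoc)
  \<comment> \<open>Coefficient of \<open>x\<close> in \<open>theta_dfps\<close>; the correction
    from \<open>- 4 * fps_X\<close> vanishes, since \<open>dfps i (Suc j)\<close> has constant
    coefficient 0.\<close>
  have rec: "a i j = a i (Suc j) + a (Suc i) j" for i j
  proof -
    have "fps_nth (theta (dfps i j)) 1 = a i j"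
      unfolding theta_def mult.assoc mult a_def by simp
    then show ?thesis
      unfolding theta_dfps fps_add_nth mult by (simp add: dfps_nth_0 a_def)
  qed
  have at1: "F = G \<Longrightarrow> fps_nth F 1 = fps_nth G 1" for F G :: "complex fps" by simp
  note coeffs = mult fps_add_nth fps_sub_nth fps_numeral_mult_nth dfps_nth_0 a_def[symmetric]
  \<comment> \<open>At order 1 the factor \<open>fps_X\<close> leaves only constant coefficients on
    the right, and these are 0 except for \<open>dfps 0 0\<close>. The shift relations thus become
    linear equations among the \<open>a i j\<close>.\<close>
  have 03: "a 0 3 = 0"
    using at1[OF dfps_shift_right_00] unfolding coeffs by simp
  have 13: "a 1 3 = 0"
    using at1[OF dfps_shift_right_10] unfolding coeffs by simp
  have 04: "a 0 4 = 0"
    using at1[OF dfps_shift_right_01] unfolding coeffs by simp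
  have 22: "a 2 2 = 0"
    using at1[OF dfps_shift_left_02] 13 04 unfolding coeffs by simp
  have 12: "a 1 2 = 0"
    using rec[of 1 2] 13 22 by (simp add: numeral_2_eq_2 numeral_3_eq_3)
  have 21: "a 2 1 = 0"
    using at1[OF dfps_shift_left_01] 12 03 unfolding coeffs by simp
  have 11: "a 1 1 = 0"
    using rec[of 1 1] 12 21 by (simp add: numeral_2_eq_2)
  have 02: "a 0 2 = 0"
    using rec[of 0 2] 03 12 by (simp add: numeral_2_eq_2 numeral_3_eq_3)
  have 01: "a 0 1 = 0"
    using rec[of 0 1] 02 11 by (simp add: numeral_2_eq_2)
  have 20: "a 2 0 = 2"
    using at1[OF dfps_shift_left_00] 11 02 unfolding coeffs by simp
  have 10: "a 1 0 = 2"
    using rec[of 1 0] 11 20 by (simp add: numeral_2_eq_2)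
  have "fps_nth satellite 0 = 0"
    by (simp add: satellite_def dfps_nth_0)
  moreover have "fps_nth satellite 1 = 0"
  proof -
    have *: "satellite = dfps 1 0 - 6 * (fps_X * dfps 1 0) - 2 * dfps 0 1 + 2 * (fps_X * dfps 0 1) - 2
        * (fps_X * dfps 0 0)"
      by (simp add: satellite_def algebra_simps)
    show ?thesis unfolding * coeffs 10 01 by simp
  qed
  ultimately show ?thesis using assms by (auto simp: less_2_cases_iff)
qed

lemma satellite_eq_0: "satellite = 0"
proof (rule theta_equation_trivial[where r = 2])
  show "1 * theta (theta (theta satellite)) + (14 * fps_X - 1) * theta (theta satellite) +
    (2 * fps_X + 24 * fps_X ^ 2) * theta satellite + 8 * fps_X ^ 2 * satellite = 0"
    using theta_satellite by simp
next
  fix n :: nat assume "2 \<le> n"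
  \<comment> \<open>The indicial polynomial is \<open>n^2 (n - 1)\<close>.\<close>
  then have "of_nat n ^ 3 - of_nat n ^ 2 \<noteq> (0::complex)"
    by (simp add: power3_eq_cube power2_eq_square)
  then show "fps_nth 1 0 * of_nat n ^ 3 + fps_nth (14 * fps_X - 1) 0 * of_nat n ^ 2 +
      fps_nth (2 * fps_X + 24 * fps_X ^ 2) 0 * of_nat n + fps_nth (8 * fps_X ^ 2) 0 \<noteq> (0::complex)"
    by simp
qed (rule satellite_nth)

section \<open>The third-order equation shared by both sides\<close>

text \<open>Obtained by pulling back the hypergeometric equation of \<open>\<Sum> scoef n t\<^sup>n\<close>
  along \<open>t = x\<^sup>2 / (1 - 4x)\<^sup>3\<close>.\<close>

definition ode_op :: "complex fps \<Rightarrow> complex fps" where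
  "ode_op f = (1 - 16 * fps_X) * (theta (theta (theta f)) + 12 * fps_X * theta (theta f) + (4 * fps_X
      + 16 * fps_X ^ 2) * theta f) -
    (2 * fps_X + 12 * fps_X ^ 2 + 96 * fps_X ^ 3 - 128 * fps_X ^ 4) * f -
    (12 * fps_X - 60 * fps_X ^ 2 + 192 * fps_X ^ 3) * theta f -
    24 * fps_X * (1 - 4 * fps_X) * (theta (theta f) + 4 * fps_X * theta f)"

text \<open>After multiplication by \<open>fps_X\<close> the expression is a combination, with
  polynomial cofactors, of shift relations and of \<open>satellite\<close> with its first two
  \<open>theta\<close>-iterates, all of them zero. The factor \<open>fps_X\<close> then cancels,
  since power series over a field form an integral domain.\<close>

lemma ode_op_dfps: "ode_op (dfps 0 0) = 0"
proof -
  have "fps_X * ode_op (dfps 0 0) =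
      (- 12 + 144 * fps_X - 672 * fps_X ^ 2 + 1536 * fps_X ^ 3 - 1536 * fps_X ^ 4) * (dfps 0 3 - fps_X
          * (dfps 3 0 - dfps 2 1 - dfps 1 2 + dfps 0 3 + dfps 2 0 - 2 * dfps 1 1 + dfps 0 2)) +
      (- 6 * fps_X + 42 * fps_X ^ 2 - 24 * fps_X ^ 3 - 48 * fps_X ^ 4) * ((1 - 4 * fps_X) * (dfps 2 0
          - 2 * dfps 1 1 + dfps 0 2) - 2 * fps_X * (2 * dfps 2 0 + 2 * dfps 1 1 + 3 * dfps 1 0 + dfps 0 1
          + dfps 0 0)) +
      (3 - 21 * fps_X + 84 * fps_X ^ 2 - 168 * fps_X ^ 3 + 192 * fps_X ^ 4) * ((1 - 4 * fps_X) * (dfps 3 0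
          - 2 * dfps 2 1 + dfps 1 2) - 2 * fps_X * (2 * dfps 3 0 + 2 * dfps 2 1 + 5 * dfps 2 0
          + 3 * dfps 1 1 + 4 * dfps 1 0 + dfps 0 1 + dfps 0 0)) +
      (6 - 45 * fps_X + 120 * fps_X ^ 2 - 120 * fps_X ^ 3 - 96 * fps_X ^ 4) * ((1 - 4 * fps_X) * (dfps 2 1
          - 2 * dfps 1 2 + dfps 0 3) - 2 * fps_X * (2 * dfps 2 1 + 2 * dfps 1 2 + 3 * dfps 1 1 + dfps 0 2
          + dfps 0 1)) +
      (- 6 * fps_X + 32 * fps_X ^ 2 - 64 * fps_X ^ 3 - 16 * fps_X ^ 4) * satellite +
      (- 18 * fps_X + 92 * fps_X ^ 2 - 176 * fps_X ^ 3) * theta satellite +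
      (- 3 + 16 * fps_X - 28 * fps_X ^ 2) * theta (theta satellite)"
    unfolding ode_op_def theta_satellite2 theta_dfps_00_3 unfolding theta_satellite1 theta_dfps_00_2
    unfolding satellite_def theta_dfps_00_1 by algebra
  also have "\<dots> = 0"
    by (simp only: dfps_shift_diffs satellite_eq_0 theta_simps mult_zero_right add_0_right)
  finally show ?thesis by simp
qed

text \<open>Applied to this product, the operator gives a multiple of the hypergeometric recurrence.
  The leading coefficients agree because
  \<open>(1 - 4x)^3 - 108x^2 = (1 - 16x)(1 + 2x)^2\<close>.\<close>

lemma ode_op_sfps: "ode_op (rfps * sfps 0) = 0"
proof -
  have 1: "theta (rfps * sfps 0) = rfps * (2 * fps_X * sfps 0 + (2 + 4 * fps_X) * sfps 1)"
    unfolding theta_simps theta_rfps theta_sfps nat_numeral_Suc by algebra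
  have 2: "theta (theta (rfps * sfps 0)) = rfps * (2 * fps_X * (2 * fps_X * sfps 0 + (2 + 4 * fps_X) * sfps 1) +
     2 * fps_X * (1 - 4 * fps_X) * sfps 0 + 2 * fps_X * (2 + 4 * fps_X) * sfps 1 +
     4 * fps_X * (1 - 4 * fps_X) * sfps 1 + (2 + 4 * fps_X)\<^sup>2 * sfps 2)"
    unfolding 1 theta_simps theta_rfps theta_sfps nat_numeral_Suc by algebra
  have "ode_op (rfps * sfps 0) = 8 * (1 + 2 * fps_X) * rfps * ((1 - 4 * fps_X) ^ 3 * sfps 3 -
      6 * fps_X\<^sup>2 * (18 * sfps 3 + 27 * sfps 2 + 13 * sfps 1 + 2 * sfps 0))"
    unfolding ode_op_def 2 unfolding 1 theta_simps theta_X_power theta_rfps theta_sfps nat_numeral_Suc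
        of_nat_numeral power2_eq_square by algebra
  then show ?thesis by (simp add: sfps_recurrence)
qed

lemma dfps_eq_sfps: "dfps 0 0 = rfps * sfps 0"
proof -
  let ?f = "dfps 0 0 - rfps * sfps 0"
  have "?f = 0"
  proof (rule theta_equation_trivial[where r = 1])
    have "ode_op ?f = ode_op (dfps 0 0) - ode_op (rfps * sfps 0)"
      unfolding ode_op_def theta_simps(2) by algebra
    then have "ode_op ?f = 0" by (simp add: ode_op_dfps ode_op_sfps)
    \<comment> \<open>Regrouped so that every lower-order coefficient carries a factor
      \<open>fps_X\<close>. The indicial polynomial is then \<open>n^3\<close>, and only the
      constant coefficient of \<open>?f\<close> remains to be checked.\<close>
    then show "(1 - 16 * fps_X) * theta (theta (theta ?f)) +
      ((1 - 16 * fps_X) * 12 - 24 * (1 - 4 * fps_X)) * fps_X * theta (theta ?f) +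
      ((1 - 16 * fps_X) * (4 + 16 * fps_X) - (12 - 60 * fps_X + 192 * fps_X ^ 2) - 24 * (1
          - 4 * fps_X) * 4 * fps_X) * fps_X * theta ?f +
      (- (2 + 12 * fps_X + 96 * fps_X ^ 2 - 128 * fps_X ^ 3) * fps_X) * ?f = 0"
      unfolding ode_op_def by algebra
  next
    fix n :: nat assume "n < 1"
    have "smom 0 0 = 1"
    proof -
      have "(\<lambda>n. sterm 0 n 0) = (\<lambda>n. if n = 0 then 1 else 0)"
        by (auto simp: sterm_def scoef_def power_0_left)
      then show ?thesis
        unfolding smom_def using sums_unique[OF sums_single[of 0 "\<lambda>_. 1::complex"]] by simp
    qed
    then have "fps_nth (sfps 0) 0 = 1" "fps_nth rfps 0 = 1"
      using has_fps_expansion_imp_0_eq_fps_nth_0[OF smom_fps[of 0]]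
        has_fps_expansion_imp_0_eq_fps_nth_0[OF rsqrt_fps] by (simp_all add: rsqrt_def)
    then show "fps_nth ?f n = 0" using \<open>n < 1\<close> by (simp add: dfps_nth_0)
  qed simp
  then show ?thesis by simp
qed

section \<open>Return to functions and the final identity\<close>

lemma fps_eq_imp_eventually_eq:
  assumes "f has_fps_expansion F" "g has_fps_expansion F"
  shows "\<forall>\<^sub>F x in nhds 0. f x = g x"
proof -
  have "\<forall>\<^sub>F x in nhds 0. eval_fps F x = f x" "\<forall>\<^sub>F x in nhds 0. eval_fps F x = g x"
    using assms by (simp_all add: has_fps_expansion_def)
  then show ?thesis by eventually_elim simp
qed

text \<open>Adding \<open>2 * (1 - fps_X)\<close> times relation 1 to \<open>1 - 4 * fps_X\<close>
  times relation 2 cancels \<open>dfps 0 1\<close>. The coefficient of \<open>dfps 1 0\<close>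
  becomes \<open>2(1 - x) + (1 - 6x)(1 - 4x) = 3(1 - 4x + 8x^2)\<close>, the source of the
  denominator in \<open>A\<close> and \<open>B\<close>.\<close>

lemma dfps_10_eq:
  "3 * (1 - 4 * fps_X + 8 * fps_X ^ 2) * dfps 1 0 =
    rfps * (4 * (1 + 2 * fps_X) * (1 - fps_X) * sfps 1 + 3 * (2 * fps_X * (1 - 2 * fps_X)) * sfps 0)"
proof -
  have "theta (dfps 0 0) = theta (rfps * sfps 0)" by (simp only: dfps_eq_sfps)
  then have 1: "(1 - 4 * fps_X) * dfps 0 1 + dfps 1 0 =
      2 * fps_X * rfps * sfps 0 + rfps * ((2 + 4 * fps_X) * sfps 1)"
    unfolding theta_simps theta_rfps theta_sfps theta_dfps nat_numeral_Suc .
  have 2: "(1 - 6 * fps_X) * dfps 1 0 - 2 * (1 - fps_X) * dfps 0 1 - 2 * fps_X * (rfps * sfps 0) = 0"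
    using satellite_eq_0 unfolding satellite_def dfps_eq_sfps .
  show ?thesis using 1 2 by algebra
qed

theorem theorem5p2:
  fixes a b :: complex
  shows "\<forall>\<^sub>F x :: complex in nhds 0.
    (let A = 4 * a * (1 + 2 * x) * (1 - x) / (3 * (1 - 4 * x + 8 * x ^ 2) * csqrt (1 - 4 * x));
         B = 1 / csqrt (1 - 4 * x) * (2 * a * x * (1 - 2 * x) / (1 - 4 * x + 8 * x ^ 2) + b);
         f = (\<lambda>n. of_nat ((2 * n) choose n) * (a * of_nat n + b) * (x ^ n / (1 - 4 * x) ^ n) *
               (\<Sum>k = 0..n. of_nat ((n choose k) ^ 2 * ((n + k) choose k)) * x ^ k));
         g = (\<lambda>n. of_nat (((3 * n) choose n) * ((2 * n) choose n) ^ 2) * (A * of_nat n + B) *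
               (x ^ (2 * n) / (1 - 4 * x) ^ (3 * n)))
     in summable f \<and> summable g \<and> (\<Sum>n. f n) = (\<Sum>n. g n))"
proof -
  \<comment> \<open>Both sides of the claim are linear in \<open>a\<close> and \<open>b\<close>:
    \<open>F\<close> supplies the coefficient of \<open>b\<close>, and \<open>N\<close> that of
    \<open>a\<close>.\<close>
  have F: "\<forall>\<^sub>F x in nhds 0. dmom 0 0 x = rsqrt x * smom 0 x"
    by (rule fps_eq_imp_eventually_eq[OF dmom_fps], unfold dfps_eq_sfps)
       (intro fps_expansion_intros rsqrt_fps smom_fps)
  have N: "\<forall>\<^sub>F x in nhds 0. 3 * (1 - 4 * x + 8 * x ^ 2) * dmom 1 0 x =
      rsqrt x * (4 * (1 + 2 * x) * (1 - x) * smom 1 x + 3 * (2 * x * (1 - 2 * x)) * smom 0 x)"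
  proof (rule fps_eq_imp_eventually_eq)
    show "(\<lambda>x. 3 * (1 - 4 * x + 8 * x ^ 2) * dmom 1 0 x) has_fps_expansion
        3 * (1 - 4 * fps_X + 8 * fps_X ^ 2) * dfps 1 0"
      by (intro fps_expansion_intros dmom_fps)
    show "(\<lambda>x. rsqrt x * (4 * (1 + 2 * x) * (1 - x) * smom 1 x + 3 * (2 * x * (1 - 2 * x)) * smom 0 x))
        has_fps_expansion 3 * (1 - 4 * fps_X + 8 * fps_X ^ 2) * dfps 1 0"
      unfolding dfps_10_eq by (intro fps_expansion_intros rsqrt_fps smom_fps)
  qed
  \<comment> \<open>The polynomial has value 1 at 0; its being nonzero nearby permits solving
    \<open>N\<close> for \<open>dmom 1 0 x\<close>.\<close>
  have Q: "\<forall>\<^sub>F x :: complex in nhds 0. 1 - 4 * x + 8 * x ^ 2 \<noteq> 0"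
  proof -
    have "((\<lambda>x::complex. 1 - 4 * x + 8 * x ^ 2) \<longlongrightarrow> 1 - 4 * 0 + 8 * 0 ^ 2) (nhds 0)"
      by (intro tendsto_intros filterlim_ident)
    then show ?thesis by (rule tendsto_imp_eventually_ne) simp
  qed
  show ?thesis
    using F N Q eventually_nhds_in_open[OF open_disc zero_in_disc]
  proof eventually_elim
    case (elim x)
    define A where "A = 4 * a * (1 + 2 * x) * (1 - x) / (3 * (1 - 4 * x + 8 * x ^ 2) * csqrt (1 - 4 * x))"
    define B where "B = 1 / csqrt (1 - 4 * x) * (2 * a * x * (1 - 2 * x) / (1 - 4 * x + 8 * x ^ 2) + b)"
    define f where "f = (\<lambda>n. of_nat ((2 * n) choose n) * (a * of_nat n + b) * (x ^ n / (1
        - 4 * x) ^ n) *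
               (\<Sum>k = 0..n. of_nat ((n choose k) ^ 2 * ((n + k) choose k)) * x ^ k))"
    define g where "g = (\<lambda>n. of_nat (((3 * n) choose n) * ((2 * n) choose n) ^ 2) * (A * of_nat n + B) *
               (x ^ (2 * n) / (1 - 4 * x) ^ (3 * n)))"
    have x: "x \<in> disc" by fact
    have "f n = a * dterm 1 0 n x + b * dterm 0 0 n x" for n
      unfolding f_def dterm_def sum_distrib_left sum.distrib[symmetric] atLeast0AtMost
      by (intro sum.cong) (simp_all add: coef_def power_divide algebra_simps)
    then have f: "f sums (a * dmom 1 0 x + b * dmom 0 0 x)"
      using sums_add[OF sums_mult[OF dterm_sums[OF x]] sums_mult[OF dterm_sums[OF x]]] by presburger
    have "g n = A * sterm 1 n x + B * sterm 0 n x" for n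
    proof -
      have "x ^ (2 * n) / (1 - 4 * x) ^ (3 * n) = (x\<^sup>2 / (1 - 4 * x) ^ 3) ^ n"
        by (simp add: power_divide power_mult)
      then show ?thesis
        unfolding g_def sterm_def by (simp add: scoef_def algebra_simps)
    qed
    then have g: "g sums (A * smom 1 x + B * smom 0 x)"
      using sums_add[OF sums_mult[OF sterm_sums[OF x]] sums_mult[OF sterm_sums[OF x]]] by presburger
    define q s where "q = 1 - 4 * x + 8 * x ^ 2" and "s = csqrt (1 - 4 * x)"
    have nz: "q \<noteq> 0" "s \<noteq> 0"
      using elim disc_bounds(3)[OF x] by (auto simp: q_def s_def)
    have D: "dmom 1 0 x = rsqrt x * (4 * (1 + 2 * x) * (1 - x) * smom 1 x + 3 * (2 * x * (1
        - 2 * x)) * smom 0 x) / (3 * q)"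
      using elim(2) nz(1) unfolding q_def[symmetric] by (simp add: field_simps)
    have "a * dmom 1 0 x + b * dmom 0 0 x = A * smom 1 x + B * smom 0 x"
      unfolding D elim(1) A_def B_def rsqrt_def q_def[symmetric] s_def[symmetric]
      using nz by (simp add: field_simps)
    then have "summable f \<and> summable g \<and> suminf f = suminf g"
      using f g by (simp add: sums_iff)
    then show ?case
      unfolding f_def g_def A_def B_def Let_def .
  qed
qed

end
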